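(* For every integer $n\ge 3$, the pair $(\mathrm{cDes},\rho)$, with $\mathrm{cDes}$ and $\rho$ as defined in the context, is a cyclic extension of $\mathrm{Des}$ on $\mathbf M_n^*$.
   Context: Write $[n]=\{1,\dots,n\}$ and let $2^{X}$ denote the power set of $X$. Cyclic extension. Let $\mathcal F$ be a finite set with a map $\mathrm{Des}:\mathcal F\to 2^{[n-1]}$. A cyclic extension of $\mathrm{Des}$ is a pair $(\mathrm{cDes},p)$, where $\mathrm{cDes}:\mathcal F\to 2^{[n]}$ is a map and $p:\mathcal F\to\mathcal F$ is a bijection, such that for all $F\in\mathcal F$: (extension) $\mathrm{cDes}(F)\cap[n-1]=\mathrm{Des}(F)$; (equivariance) $\mathrm{cDes}(p(F))=\mathrm{cDes}(F)+1$, where $1$ is added to every element modulo $n$ (so $n$ becomes $1$); (non-Escher) $\varnothing\subsetneq \mathrm{cDes}(F)\subsetneq[n]$. Motzkin paths. A Motzkin path of length $n$ is a lattice path from $(0,0)$ to $(n,0)$ with steps $U=(1,1)$, $D=(1,-1)$, $L=(1,0)$ that never passes below the $x$-axis; it is identified with its word of steps. $\mathbf M_n$ is the set of Motzkin paths of length $n$, $L^n$ is the path all of whose steps are $L$, and $\mathbf M_n^*=\mathbf M_n\setminus\{L^n\}$. A return is a $D$ step ending on the $x$-axis; a start is a $U$ step starting on the $x$-axis. Descents (order $U>D>L$). $\mathrm{Des}(M)\subseteq[n-1]$ is the set of $i$ such that the $i$th and $(i+1)$st steps of $M$ are $UD$, $UL$ or $DL$ (in this order). Cyclic descents. $\mathrm{cDes}(M)\cap[n-1]=\mathrm{Des}(M)$,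 and $n\in\mathrm{cDes}(M)$ if and only if one of the following holds: (1) the first step of $M$ is $L$ and the final step is $D$; (2) the first step of $M$ is $U$, the final step is $D$, and $M$ has no returns before the rightmost $D$. The map $\rho$. For $M\in\mathbf M_n^*$: (1) if the final step of $M$ is $L$, write $M=PL$ and set $\rho M=LP$; (2) if the final step of $M$ is $D$, write $M=PUP'D$, where the displayed $U$ is the last start step of $M$ and $P,P'$ are (possibly empty) Motzkin paths, and set $\rho M=UPDP'$. *)

theory Defs
  imports Main
begin

text \<open>
  Adding 1 modulo \<open>n\<close> with representatives \<open>1, ..., n\<close>, so that \<open>n\<close> is sent to \<open>1\<close>.
\<close>
definition cyc_shift :: "nat \<Rightarrow> nat set \<Rightarrow> nat set" where
  "cyc_shift n A = (\<lambda>i. i mod n + 1) ` A"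

text \<open>
  The first three conjuncts are the typing conditions of the notion: \<open>F\<close> is finite and \<open>des\<close>, \<open>cdes\<close>
  take values in the subsets of \<open>[n-1]\<close> and \<open>[n]\<close>.
\<close>
definition cyclic_extension ::
  "nat \<Rightarrow> 'a set \<Rightarrow> ('a \<Rightarrow> nat set) \<Rightarrow> ('a \<Rightarrow> nat set) \<Rightarrow> ('a \<Rightarrow> 'a) \<Rightarrow> bool" where
  "cyclic_extension n F des cdes p \<longleftrightarrow>
     finite F \<and>
     (\<forall>x\<in>F. des x \<subseteq> {1..n-1}) \<and>
     (\<forall>x\<in>F. cdes x \<subseteq> {1..n}) \<and>
     bij_betw p F F \<and>
     (\<forall>x\<in>F. cdes x \<inter> {1..n-1} = des x) \<and>
     (\<forall>x\<in>F. cdes (p x) = cyc_shift n (cdes x)) \<and>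
     (\<forall>x\<in>F. {} \<subset> cdes x \<and> cdes x \<subset> {1..n})"

datatype step = U | D | L

text \<open>
  Every step advances the abscissa by 1, so the lattice point reached after \<open>i\<close> steps of the word
  \<open>w\<close> is \<open>(i, height w i)\<close>.
\<close>
fun rise :: "step \<Rightarrow> int" where
  "rise U = 1"
| "rise D = -1"
| "rise L = 0"

definition height :: "step list \<Rightarrow> nat \<Rightarrow> int" where
  "height w i = sum_list (map rise (take i w))"

definition Motzkin :: "nat \<Rightarrow> step list set" where
  "Motzkin n = {w. length w = n \<and> height w n = 0 \<and> (\<forall>i\<le>n. 0 \<le> height w i)}"

definition Motzkin_star :: "nat \<Rightarrow> step list set" where
  "Motzkin_star n = Motzkin n - {replicate n L}"

text \<open>
  In \<open>is_return\<close> and \<open>is_start\<close> the steps are indexed from 0, as for \<open>(!)\<close>: the step \<open>w ! i\<close> runs from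
  height \<open>height w i\<close> to height \<open>height w (i + 1)\<close>. Descents, in contrast, are numbered from 1.
\<close>
definition is_return :: "step list \<Rightarrow> nat \<Rightarrow> bool" where
  "is_return w i \<longleftrightarrow> i < length w \<and> w ! i = D \<and> height w (i + 1) = 0"

definition is_start :: "step list \<Rightarrow> nat \<Rightarrow> bool" where
  "is_start w i \<longleftrightarrow> i < length w \<and> w ! i = U \<and> height w i = 0"

definition Des :: "step list \<Rightarrow> nat set" where
  "Des w = {i. 1 \<le> i \<and> i < length w \<and> (w ! (i - 1), w ! i) \<in> {(U, D), (U, L), (D, L)}}"

definition cDes :: "step list \<Rightarrow> nat set" where
  "cDes w = Des w \<union>
     (if (hd w = L \<and> last w = D) \<or>
         (hd w = U \<and> last w = D \<and>
          (\<forall>i < Max {j. j < length w \<and> w ! j = D}. \<not> is_return w i))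
      then {length w} else {})"

text \<open>
  A nonempty Motzkin path ends with \<open>L\<close> or \<open>D\<close>. In the second case, if \<open>s\<close> is the position of the last
  start, then \<open>w = P @ U # P' @ [D]\<close> with \<open>P = take s w\<close> and \<open>P' = butlast (drop (s + 1) w)\<close>.
\<close>
definition rho :: "step list \<Rightarrow> step list" where
  "rho w =
     (if last w = L then L # butlast w
      else (let s = Max {i. is_start w i};
                P = take s w;
                P' = butlast (drop (s + 1) w)
            in U # P @ D # P'))"

end

theory Submission
  imports Defs
begin

text \<open>
  Both forms of the image, \<open>L P\<close> and \<open>U P D P'\<close>, are first-return decompositions, and these are
  unique; so \<open>\<rho>\<close> is injective on a finite set. For equivariance, a Motzkin path neither starts with
  \<open>D\<close> nor ends with \<open>U\<close>, hence in \<open>P U P' D\<close> and \<open>U P D P'\<close> descents at the seams occur only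
  right after the displayed \<open>U\<close> and \<open>D\<close> steps. There is one right after the displayed \<open>U\<close> of the
  preimage, at position \<open>|P| + 1\<close>, exactly when \<open>P'\<close> is empty or starts with \<open>L\<close>, which is when \<open>|P| + 2\<close>
  is a cyclic descent of the image. Likewise, \<open>n\<close> is a cyclic descent of the preimage exactly when
  \<open>P\<close> is empty or starts with \<open>L\<close>, which is when \<open>1\<close> is a descent of the image.
\<close>

section \<open>Heights, and Motzkin words of unspecified length\<close>

lemma height_0 [simp]: "height w 0 = 0"
  by (simp add: height_def)

lemma height_Nil [simp]: "height [] i = 0"
  by (simp add: height_def)

lemma height_Cons_Suc [simp]: "height (x # w) (Suc i) = rise x + height w i"
  by (simp add: height_def)

lemma height_append: "height (a @ b) i = height a i + height b (i - length a)"
  by (simp add: height_def)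

lemma height_beyond: "length a \<le> i \<Longrightarrow> height a i = sum_list (map rise a)"
  by (simp add: height_def)

lemma height_take: "height (take k w) i = height w (min i k)"
  by (simp add: height_def)

lemma height_Suc: "i < length w \<Longrightarrow> height w (Suc i) = height w i + rise (w ! i)"
  by (simp add: height_def take_Suc_conv_app_nth)

text \<open>The height is constant beyond the end of a word, so nonnegativity can be asked at every
  index, which spares bounds when words are split.\<close>

definition motzkin_word :: "step list \<Rightarrow> bool" where
  "motzkin_word w \<longleftrightarrow> height w (length w) = 0 \<and> (\<forall>i. 0 \<le> height w i)"

lemma Motzkin_iff: "w \<in> Motzkin n \<longleftrightarrow> length w = n \<and> motzkin_word w"
  unfolding Motzkin_def motzkin_word_def
  by auto (metis height_beyond nat_le_linear)

lemma Motzkin_star_iff: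
  "w \<in> Motzkin_star n \<longleftrightarrow> length w = n \<and> motzkin_word w \<and> \<not> set w \<subseteq> {L}"
proof -
  have "w = replicate n L \<longleftrightarrow> set w \<subseteq> {L}" if "length w = n"
    using that replicate_eqI[of w n L] by (metis in_set_replicate singleton_iff subset_iff)
  then show ?thesis by (auto simp: Motzkin_star_def Motzkin_iff)
qed

lemma motzkin_word_Nil [simp]: "motzkin_word []"
  by (simp add: motzkin_word_def)

lemma motzkin_word_height_nonneg: "motzkin_word w \<Longrightarrow> 0 \<le> height w i"
  by (simp add: motzkin_word_def)

lemma motzkin_word_height_beyond: "motzkin_word w \<Longrightarrow> length w \<le> i \<Longrightarrow> height w i = 0"
  by (simp add: motzkin_word_def height_beyond)

text \<open>After \<open>a\<close> the height is back at 0, so \<open>b\<close> is traversed at its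
  own heights. This lets Motzkin prefixes be stripped off and put back.\<close>

lemma motzkin_word_append_iff:
  assumes "motzkin_word a"
  shows "motzkin_word (a @ b) \<longleftrightarrow> motzkin_word b"
proof
  assume *: "motzkin_word (a @ b)"
  have "height b i = height (a @ b) (length a + i)" for i
    using assms by (simp add: height_append motzkin_word_height_beyond)
  with * show "motzkin_word b"
    by (simp add: motzkin_word_def)
next
  assume "motzkin_word b"
  with assms show "motzkin_word (a @ b)"
    by (simp add: motzkin_word_def height_append height_beyond)
qed

text \<open>Heights along \<open>P\<close> are raised by 1, which leaves room for the final
  \<open>D\<close>.\<close>

lemma motzkin_word_elevate:
  assumes "motzkin_word P"
  shows "motzkin_word (U # P @ [D])"
proof -
  have "0 \<le> height (U # P @ [D]) i" for i
  proof (cases i)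
    case (Suc j)
    have "-1 \<le> height [D] (j - length P)" by (cases "j - length P") auto
    with Suc motzkin_word_height_nonneg[OF assms, of j] show ?thesis
      by (simp add: height_append)
  qed simp
  then show ?thesis
    using assms by (simp add: motzkin_word_def height_append height_beyond)
qed

lemma motzkin_word_U_D_iff:
  "motzkin_word P \<Longrightarrow> motzkin_word (U # P @ D # Q) \<longleftrightarrow> motzkin_word Q"
  using motzkin_word_append_iff[OF motzkin_word_elevate, of P Q] by simp

lemma motzkin_word_L [simp]: "motzkin_word [L]"
proof -
  have "height [L] i = 0" for i by (cases i) auto
  then show ?thesis by (simp add: motzkin_word_def)
qed

lemma motzkin_word_Cons_L_iff [simp]: "motzkin_word (L # w) \<longleftrightarrow> motzkin_word w"
  using motzkin_word_append_iff[OF motzkin_word_L, of w] by simp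

lemma not_motzkin_word_Cons_D [simp]: "\<not> motzkin_word (D # w)"
proof
  assume "motzkin_word (D # w)"
  from motzkin_word_height_nonneg[OF this, of 1] show False by simp
qed

lemma motzkin_word_hd: "motzkin_word w \<Longrightarrow> w \<noteq> [] \<Longrightarrow> hd w \<noteq> D"
  by (cases w) auto

lemma motzkin_word_last:
  assumes "motzkin_word w" "w \<noteq> []"
  shows "last w \<noteq> U"
proof
  assume "last w = U"
  with assms(2) obtain v where w: "w = v @ [U]"
    by (metis append_butlast_last_id)
  have "height w (length w) = height w (length v) + 1"
    by (simp add: w height_append height_beyond)
  with assms motzkin_word_height_nonneg[OF assms(1), of "length v"] show False
    by (simp add: motzkin_word_def)
qed

lemma motzkin_word_snoc_L:
  assumes "motzkin_word (w @ [L])"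
  shows "motzkin_word w"
proof -
  have "height [L] i = 0" for i by (cases i) auto
  then have "height (w @ [L]) = height w" by (auto simp: height_append fun_eq_iff)
  with assms show ?thesis
    by (simp add: motzkin_word_def height_beyond)
qed

section \<open>First-return and last-start decompositions\<close>

lemma motzkin_word_first_return:
  assumes "motzkin_word (U # v)"
  obtains P Q where "v = P @ D # Q" "motzkin_word P" "motzkin_word Q"
proof -
  have ge: "-1 \<le> height v i" for i
    using motzkin_word_height_nonneg[OF assms, of "Suc i"] by simp
  have "height v (length v) = -1"
    using assms by (simp add: motzkin_word_def)
  \<comment> \<open>The first visit of \<open>v\<close> to height -1 is the first return of
    \<open>U # v\<close> to the axis.\<close>
  define k where "k = (LEAST i. height v i = -1)"
  have k: "height v k = -1" "k \<le> length v"
    unfolding k_def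
    by (rule LeastI, fact) (rule Least_le, fact)
  have less: "0 \<le> height v i" if "i < k" for i
    using not_less_Least[OF that[unfolded k_def]] ge[of i] by simp
  from k obtain j where j: "k = Suc j" by (cases k) auto
  have "j < length v" using j k by simp
  \<comment> \<open>A step from a nonnegative height to -1 can only be \<open>D\<close>, taken from
    height 0.\<close>
  have *: "height v j = 0" "v ! j = D"
    using height_Suc[OF \<open>j < length v\<close>] less[of j] k j
    by (cases "v ! j"; simp)+
  have v: "v = take j v @ D # drop k v"
    using id_take_nth_drop[OF \<open>j < length v\<close>] * j by simp
  have P: "motzkin_word (take j v)"
    using less * \<open>j < length v\<close> j by (simp add: motzkin_word_def height_take)
  show thesis
    using that[OF v P] motzkin_word_U_D_iff[OF P] assms v by metis
qed

text \<open>Nonempty Motzkin prefixes, single \<open>L\<close> steps or arches \<open>U P D\<close>,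
  are peeled off the front and collected in \<open>P\<close>. As the word ends with
  \<open>D\<close>, the last piece is an arch.\<close>

lemma motzkin_word_last_start:
  assumes "motzkin_word w" "w \<noteq> []" "last w = D"
  obtains P P' where "w = P @ U # P' @ [D]" "motzkin_word P" "motzkin_word P'"
proof -
  have "\<exists>P P'. w = P @ U # P' @ [D] \<and> motzkin_word P \<and> motzkin_word P'"
    using assms
  proof (induction w rule: length_induct)
    case (1 w)
    have step: "\<exists>P P'. a @ b = P @ U # P' @ [D] \<and> motzkin_word P \<and> motzkin_word P'"
      if ab: "w = a @ b" "motzkin_word a" "a \<noteq> []" "b \<noteq> []" for a b
    proof -
      have "length b < length w" "motzkin_word b" "last b = D"
        using ab 1(2,4) motzkin_word_append_iff[of a b] by auto
      with 1(1) ab obtain P P' where "b = P @ U # P' @ [D]" "motzkin_word P" "motzkin_word P'"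
        by blast
      then have "a @ b = (a @ P) @ U # P' @ [D] \<and> motzkin_word (a @ P) \<and> motzkin_word P'"
        using ab motzkin_word_append_iff[of a P] by simp
      then show ?thesis by blast
    qed
    obtain x v where w: "w = x # v" using 1(3) by (cases w) auto
    show ?case
    proof (cases x)
      case U
      then obtain P Q where v: "v = P @ D # Q" "motzkin_word P" "motzkin_word Q"
        using motzkin_word_first_return 1(2) w by metis
      show ?thesis
      proof (cases "Q = []")
        case True
        then have "w = [] @ U # P @ [D] \<and> motzkin_word [] \<and> motzkin_word P"
          using v w U by simp
        then show ?thesis by blast
      next
        case False
        then show ?thesis
          using step[of "U # P @ [D]" Q] v w U motzkin_word_elevate by simp
      qed
    next
      case L
      \<comment> \<open>With \<open>v = []\<close> the word would end with \<open>L\<close>.\<close>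
      then show ?thesis using step[of "[L]" v] w 1(4) by (cases "v = []") auto
    qed (use 1(2) w in auto)
  qed
  with that show thesis by blast
qed

text \<open>If \<open>P\<close> were shorter than \<open>Q\<close>, the height -1 reached just after
  \<open>P @ [D]\<close> would occur inside \<open>Q\<close>. Exchanging the roles gives equal
  lengths.\<close>

lemma motzkin_word_first_return_unique:
  assumes "P @ D # P' = Q @ D # Q'" "motzkin_word P" "motzkin_word Q"
  shows "P = Q \<and> P' = Q'"
proof -
  have le: "length Q \<le> length P"
    if eq: "P @ D # P' = Q @ D # Q'" and "motzkin_word P" "motzkin_word Q" for P P' Q Q'
  proof (rule ccontr)
    assume "\<not> length Q \<le> length P"
    then have lt: "Suc (length P) \<le> length Q" by simp
    have "height (P @ D # P') (Suc (length P)) = -1"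
      using \<open>motzkin_word P\<close> by (simp add: height_append motzkin_word_height_beyond)
    moreover have "height (Q @ D # Q') (Suc (length P)) = height Q (Suc (length P))"
      using lt by (simp add: height_append)
    ultimately show False
      using motzkin_word_height_nonneg[OF \<open>motzkin_word Q\<close>] eq
      by (metis neg_0_le_iff_le not_one_le_zero)
  qed
  from le[OF assms] le[OF assms(1)[symmetric] assms(3,2)] have "length P = length Q" by simp
  with assms(1) show ?thesis by simp
qed

text \<open>Once leading \<open>L\<close> steps are stripped, the next step cannot be
  \<open>D\<close>.\<close>

lemma motzkin_word_U_in_set:
  assumes "motzkin_word w" "\<not> set w \<subseteq> {L}"
  shows "U \<in> set w"
  using assms
proof (induction w)
  case (Cons x w)
  then show ?case by (cases x) auto
qed simp

section \<open>The map \<open>rho\<close> and its bijectivity\<close>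

lemma rho_snoc_L [simp]: "rho (P @ [L]) = L # P"
  by (simp add: rho_def)

text \<open>Inside \<open>P'\<close> the path runs at height at least 1, so no start follows the
  displayed \<open>U\<close>.\<close>

lemma rho_last_start:
  assumes "motzkin_word P" "motzkin_word P'"
  shows "rho (P @ U # P' @ [D]) = U # P @ D # P'"
proof -
  let ?w = "P @ U # P' @ [D]"
  have "Max {i. is_start ?w i} = length P"
  proof (rule Max_eqI)
    show "finite {i. is_start ?w i}" by (auto simp: is_start_def)
    show "length P \<in> {i. is_start ?w i}"
      using assms by (auto simp: is_start_def height_append motzkin_word_height_beyond)
  next
    fix i assume "i \<in> {i. is_start ?w i}"
    then have i: "i < length ?w" "?w ! i = U" "height ?w i = 0"
      by (auto simp: is_start_def)
    show "i \<le> length P"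
    proof (rule ccontr)
      assume "\<not> i \<le> length P"
      then obtain j where j: "i = length P + Suc j"
        using less_imp_Suc_add not_le by (metis add_Suc_right)
      \<comment> \<open>The step at \<open>i\<close> is \<open>U\<close>, so it is not the final
        \<open>D\<close>.\<close>
      with i have "j < length P'"
        by (auto simp: nth_append split: if_splits)
      then have "height ?w i = 1 + height P' j"
        using j assms by (simp add: height_append motzkin_word_height_beyond)
      with motzkin_word_height_nonneg[OF assms(2), of j] i show False by simp
    qed
  qed
  then show ?thesis by (simp add: rho_def Let_def)
qed

text \<open>Each case of \<open>rho\<close> comes with its image, so that later case splits avoid
  the \<open>Max\<close> in the definition.\<close>

lemma motzkin_word_cases:
  assumes "motzkin_word w" "w \<noteq> []"
  obtains (L) P where "w = P @ [L]" "motzkin_word P" "rho w = L # P"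
  | (D) P P' where "w = P @ U # P' @ [D]" "motzkin_word P" "motzkin_word P'"
      "rho w = U # P @ D # P'"
proof (cases "last w")
  case U
  then show ?thesis using motzkin_word_last assms by blast
next
  case D
  then show ?thesis using motzkin_word_last_start assms rho_last_start that(2) by metis
next
  case L
  then obtain P where "w = P @ [L]" using assms(2) by (metis append_butlast_last_id)
  then show ?thesis using that(1) assms(1) motzkin_word_snoc_L by simp
qed

lemma rho_in_Motzkin_star:
  assumes "w \<in> Motzkin_star n" "n > 0"
  shows "rho w \<in> Motzkin_star n"
proof -
  from assms have w: "motzkin_word w" "w \<noteq> []" "length w = n" "\<not> set w \<subseteq> {L}"
    by (auto simp: Motzkin_star_iff)
  from w(1,2) show ?thesis
  proof (cases rule: motzkin_word_cases)
    case (L P)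
    then show ?thesis using w by (auto simp: Motzkin_star_iff)
  next
    case (D P P')
    then show ?thesis using w by (auto simp: Motzkin_star_iff motzkin_word_U_D_iff)
  qed
qed

text \<open>The first step of the image, \<open>L\<close> or \<open>U\<close>, reveals which case of
  \<open>rho\<close> produced it.\<close>

lemma inj_on_rho: "n > 0 \<Longrightarrow> inj_on rho (Motzkin n)"
proof (rule inj_onI)
  fix v w assume "n > 0" "v \<in> Motzkin n" "w \<in> Motzkin n" and eq: "rho v = rho w"
  then have v: "motzkin_word v" "v \<noteq> []" and w: "motzkin_word w" "w \<noteq> []"
    by (auto simp: Motzkin_iff)
  from v show "v = w"
  proof (cases rule: motzkin_word_cases)
    case (L P)
    from w show ?thesis
      by (cases rule: motzkin_word_cases) (use L eq in auto)
  next
    case v: (D P P')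
    from w show ?thesis
    proof (cases rule: motzkin_word_cases)
      case (D Q Q')
      then show ?thesis using v eq motzkin_word_first_return_unique[of P P' Q Q'] by auto
    qed (use v eq in auto)
  qed
qed

lemma finite_Motzkin_star: "finite (Motzkin_star n)"
proof (rule finite_subset)
  have "UNIV = {U, D, L}" using step.exhaust by blast
  then have "finite (UNIV :: step set)" by (metis finite.emptyI finite_insert)
  then show "finite {w :: step list. set w \<subseteq> UNIV \<and> length w = n}"
    by (rule finite_lists_length_eq)
qed (auto simp: Motzkin_star_iff)

lemma bij_betw_rho: "n > 0 \<Longrightarrow> bij_betw rho (Motzkin_star n) (Motzkin_star n)"
  unfolding bij_betw_def
proof
  assume "n > 0"
  then show inj: "inj_on rho (Motzkin_star n)"
    by (auto intro: inj_on_subset[OF inj_on_rho] simp: Motzkin_star_def)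
  show "rho ` Motzkin_star n = Motzkin_star n"
    using inj rho_in_Motzkin_star \<open>n > 0\<close>
    by (intro endo_inj_surj finite_Motzkin_star) auto
qed

section \<open>Descents of concatenated words\<close>

abbreviation descent :: "step \<Rightarrow> step \<Rightarrow> bool" where
  "descent x y \<equiv> (x, y) \<in> {(U, D), (U, L), (D, L)}"

lemma Des_subset: "Des w \<subseteq> {1..length w - 1}"
  by (auto simp: Des_def)

lemma Des_singleton [simp]: "Des [x] = {}"
  by (auto simp: Des_def)

text \<open>A descent depends on two adjacent steps only, so gluing can create one at the seam and
  nowhere else.\<close>

lemma Des_append:
  assumes "a \<noteq> []" "b \<noteq> []"
  shows "Des (a @ b) = Des a \<union> (if descent (last a) (hd b) then {length a} else {})
    \<union> (+) (length a) ` Des b"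
proof -
  have "i \<in> Des (a @ b) \<longleftrightarrow> i \<in> Des a \<or> i = length a \<and> descent (last a) (hd b)
      \<or> i \<in> (+) (length a) ` Des b" for i
  proof -
    consider "i < length a" | "i = length a" | j where "i = length a + Suc j"
      by (metis add_Suc_right less_imp_Suc_add linorder_neqE_nat)
    then show ?thesis
    proof cases
      case 1
      then show ?thesis by (auto simp: Des_def nth_append)
    next
      case 2
      have "i \<in> Des (a @ b) \<longleftrightarrow> descent (last a) (hd b)"
        using assms 2 by (simp add: Des_def nth_append last_conv_nth hd_conv_nth Suc_le_eq)
      moreover have "i \<notin> Des a" "i \<notin> (+) (length a) ` Des b" using 2 by (auto simp: Des_def)
      ultimately show ?thesis using 2 by blast
    next
      case 3
      have "i \<in> Des (a @ b) \<longleftrightarrow> Suc j \<in> Des b"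
        using 3 by (simp add: Des_def nth_append)
      moreover have "i \<notin> Des a" using 3 by (auto simp: Des_def)
      ultimately show ?thesis using 3 by auto
    qed
  qed
  then show ?thesis by auto
qed

lemma Des_Cons:
  "w \<noteq> [] \<Longrightarrow> Des (x # w) = (if descent x (hd w) then {1} else {}) \<union> Suc ` Des w"
  using Des_append[of "[x]" w] by auto

text \<open>A nonempty \<open>P\<close> ends with \<open>D\<close> or \<open>L\<close>. Only
  \<open>D\<close> can begin a descent, and it needs a following \<open>L\<close>.\<close>

lemma Des_append_motzkin_word:
  assumes "motzkin_word P" "b \<noteq> []" "hd b \<noteq> L"
  shows "Des (P @ b) = Des P \<union> (+) (length P) ` Des b"
proof (cases "P = []")
  case False
  with assms motzkin_word_last[OF assms(1)] Des_append[OF False assms(2)] show ?thesis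
    by auto
qed (auto simp: Des_def)

section \<open>When the length of a word is a cyclic descent\<close>

lemma Max_D:
  assumes "w \<noteq> []" "last w = D"
  shows "Max {j. j < length w \<and> w ! j = D} = length w - 1"
  using assms by (intro Max_eqI) (auto simp: last_conv_nth)

lemma cDes_L: "hd w = L \<Longrightarrow> cDes w = Des w \<union> (if last w = D then {length w} else {})"
  by (simp add: cDes_def)

lemma cDes_snoc_L: "cDes (w @ [L]) = Des (w @ [L])"
  by (simp add: cDes_def)

text \<open>The \<open>D\<close> after \<open>P\<close> is the first return. There is no return
  before the final \<open>D\<close> exactly when the two coincide.\<close>

lemma cDes_U_D:
  assumes "motzkin_word P" "motzkin_word Q"
  shows "cDes (U # P @ D # Q) =
    Des (U # P @ D # Q) \<union> (if Q = [] then {Suc (Suc (length P))} else {})"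
proof -
  let ?w = "U # P @ D # Q"
  have hP: "height (P @ D # Q) (Suc (length P)) = -1"
    using assms by (simp add: height_append motzkin_word_height_beyond)
  have ret: "is_return ?w (Suc (length P))"
    using hP by (simp add: is_return_def nth_append)
  have noret: "\<not> is_return ?w i" if "i < Suc (length P)" for i
    using that motzkin_word_height_nonneg[OF assms(1), of i]
    by (auto simp: is_return_def height_append)
  show ?thesis
  proof (cases "last ?w = D")
    case True
    have "(\<forall>i<length ?w - 1. \<not> is_return ?w i) \<longleftrightarrow> Q = []"
    proof
      assume "\<forall>i<length ?w - 1. \<not> is_return ?w i"
      with ret have "\<not> Suc (length P) < length ?w - 1" by blast
      then show "Q = []" by simp
    next
      assume "Q = []"
      then have "length ?w - 1 = Suc (length P)" by simp
      with noret show "\<forall>i<length ?w - 1. \<not> is_return ?w i" by metis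
    qed
    with True Max_D[OF _ True] show ?thesis
      by (auto simp: cDes_def)
  next
    \<comment> \<open>Here \<open>Q\<close> is nonempty, since otherwise the word would end with
      \<open>D\<close>.\<close>
    case False
    then show ?thesis by (auto simp: cDes_def)
  qed
qed

text \<open>If \<open>P\<close> is empty, the final \<open>D\<close> is the first return. If
  \<open>P\<close> starts with \<open>U\<close>, an earlier return lies inside \<open>P\<close>. If
  \<open>P\<close> starts with \<open>L\<close>, the path runs from \<open>L\<close> to
  \<open>D\<close>.\<close>

lemma cDes_last_start:
  assumes P: "motzkin_word P" and P': "motzkin_word P'"
  shows "cDes (P @ U # P' @ [D]) = Des (P @ U # P' @ [D]) \<union>
    (if P = [] \<or> hd P = L then {length P + length P' + 2} else {})"
proof (cases P)
  case Nil
  then show ?thesis using cDes_U_D[OF P', of "[]"] by simp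
next
  case (Cons x R)
  show ?thesis
  proof (cases x)
    case U
    with P Cons obtain A B where R: "R = A @ D # B" and AB: "motzkin_word A" "motzkin_word B"
      using motzkin_word_first_return by metis
    have "motzkin_word (B @ U # P' @ [D])"
      using AB P' motzkin_word_append_iff motzkin_word_elevate by simp
    from cDes_U_D[OF AB(1) this] show ?thesis
      using Cons U R by simp
  next
    case D
    then show ?thesis using P Cons by simp
  next
    case L
    then show ?thesis using Cons by (simp add: cDes_L)
  qed
qed

section \<open>Equivariance\<close>

lemma cyc_shift_Un: "cyc_shift n (A \<union> B) = cyc_shift n A \<union> cyc_shift n B"
  by (auto simp: cyc_shift_def)

lemma cyc_shift_below: "A \<subseteq> {1..n-1} \<Longrightarrow> cyc_shift n A = Suc ` A"
  unfolding cyc_shift_def by (rule image_cong) (fastforce simp: subset_iff)+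

lemma cyc_shift_top [simp]: "cyc_shift n {n} = {1}"
  by (simp add: cyc_shift_def)

lemma cyc_shift_empty [simp]: "cyc_shift n {} = {}"
  by (simp add: cyc_shift_def)

lemma cDes_rho:
  assumes w: "motzkin_word w" and len: "length w \<ge> 3"
  shows "cDes (rho w) = cyc_shift (length w) (cDes w)"
proof -
  have shift: "cyc_shift (length w) (Des w) = Suc ` Des w"
    by (rule cyc_shift_below[OF Des_subset])
  have "w \<noteq> []" using len by auto
  with w show ?thesis
  proof (cases rule: motzkin_word_cases)
    case (L P)
    then have P: "P \<noteq> []" using len by auto
    have "Des w = Des P \<union> (if last P = D then {length P} else {})"
      using L P motzkin_word_last[OF L(2) P] Des_append[OF P, of "[L]"]
      by (cases "last P") auto
    \<comment> \<open>A descent \<open>DL\<close> at the end of \<open>w\<close> turns into the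
      cyclic descent at the top of \<open>L # P\<close>, one position further. The new leading
      \<open>L\<close> begins no descent.\<close>
    moreover have "cDes (rho w) = Suc ` Des P \<union> (if last P = D then {Suc (length P)} else {})"
      using L P by (simp add: cDes_L Des_Cons)
    moreover have "cDes w = Des w" using L by (simp add: cDes_snoc_L)
    ultimately show ?thesis using shift by auto
  next
    case (D P P')
    have lenw: "length w = length P + length P' + 2" using D by simp
    \<comment> \<open>Before a nonempty \<open>P'\<close>, the steps \<open>U\<close> and
      \<open>D\<close> behave alike: both descend to \<open>L\<close>, neither to \<open>U\<close>.
      They differ only for \<open>P' = []\<close>, where \<open>UD\<close> is a descent.\<close>
    have tail: "Des (U # P' @ [D]) = Des (D # P') \<union> (if P' = [] then {1} else {})"
    proof (cases "P' = []")
      case False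
      have "Des (P' @ [D]) = Des P'"
        using D(3) by (simp add: Des_append_motzkin_word)
      then show ?thesis
        using False motzkin_word_hd[OF D(3) False] by (cases "hd P'") (auto simp: Des_Cons)
    qed (auto simp: Des_Cons)
    \<comment> \<open>Both sides are compared through \<open>P @ D # P'\<close>, which is
      \<open>rho w\<close> without its leading \<open>U\<close>.\<close>
    have Des_w: "Des w = Des (P @ D # P') \<union> (if P' = [] then {Suc (length P)} else {})"
      using D by (auto simp: Des_append_motzkin_word tail)
    have first: "descent U (hd (P @ D # P')) \<longleftrightarrow> P = [] \<or> hd P = L"
      using motzkin_word_hd[OF D(2)] by (cases P) auto
    have P_nonempty: "P' = [] \<Longrightarrow> P \<noteq> []" using len lenw by auto
    have "cDes (rho w) = (if P = [] \<or> hd P = L then {1} else {}) \<union> Suc ` Des (P @ D # P') \<union>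
        (if P' = [] then {Suc (Suc (length P))} else {})"
      unfolding D(4) cDes_U_D[OF D(2,3)] using first by (subst Des_Cons) auto
    also have "\<dots> = (if P = [] \<or> hd P = L then {1} else {}) \<union> Suc ` Des w"
      unfolding Des_w by auto
    also have "\<dots> = cyc_shift (length w) (cDes w)"
      using cDes_last_start[OF D(2,3)] shift lenw D(1) by (auto simp: cyc_shift_Un)
    finally show ?thesis .
  qed
qed

section \<open>The non-Escher property\<close>

lemma Des_nonempty:
  assumes "motzkin_word w" "\<not> set w \<subseteq> {L}"
  shows "Des w \<noteq> {}"
proof -
  \<comment> \<open>The last \<open>U\<close> is not the final step, so \<open>D\<close> or
    \<open>L\<close> follows it and makes a descent. Its 0-based index \<open>length xs\<close> is
    position \<open>length xs + 1\<close>.\<close>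
  obtain xs ys where w: "w = xs @ U # ys" "U \<notin> set ys"
    using motzkin_word_U_in_set[OF assms] split_list_last by metis
  have "ys \<noteq> []" using motzkin_word_last[OF assms(1)] w by auto
  then have "hd ys \<noteq> U" using w(2) hd_in_set by metis
  with \<open>ys \<noteq> []\<close> have "length xs + 1 \<in> Des w"
    unfolding w(1) by (cases "hd ys") (auto simp: Des_def nth_append hd_conv_nth)
  then show ?thesis by auto
qed

lemma cDes_subset: "w \<noteq> [] \<Longrightarrow> cDes w \<subseteq> {1..length w}"
  using Des_subset[of w] by (cases w) (auto simp: cDes_def)

lemma cDes_Int: "w \<noteq> [] \<Longrightarrow> cDes w \<inter> {1..length w - 1} = Des w"
  using Des_subset[of w] by (cases w) (auto simp: cDes_def)

text \<open>Descents at 1 and 2 force the word to begin with \<open>UDL\<close>, and an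
  \<open>L\<close> at position 3 gives neither a descent there nor, as the final step, a cyclic one.
  For length 2, \<open>UD\<close> has the full set as cyclic descents.\<close>

lemma cDes_psubset:
  assumes len: "length w \<ge> 3"
  shows "cDes w \<subset> {1..length w}"
proof -
  have "w \<noteq> []" using len by auto
  have "cDes w \<noteq> {1..length w}"
  proof
    assume full: "cDes w = {1..length w}"
    have Des: "i \<in> Des w" if "1 \<le> i" "i < length w" for i
      unfolding cDes_Int[OF \<open>w \<noteq> []\<close>, symmetric] full using that by auto
    have "1 \<in> Des w" "2 \<in> Des w" using Des len by auto
    then have L: "w ! 2 = L" by (auto simp: Des_def)
    show False
    proof (cases "length w = 3")
      case True
      then have "last w = L" using L \<open>w \<noteq> []\<close> by (simp add: last_conv_nth)
      then have "length w \<notin> cDes w" by (simp add: cDes_def Des_def)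
      with full True show False by simp
    next
      case False
      then have "3 \<in> Des w" using Des len by simp
      with L show False by (simp add: Des_def)
    qed
  qed
  with cDes_subset[OF \<open>w \<noteq> []\<close>] show ?thesis by auto
qed

theorem corollary1p11:
  fixes n :: nat
  assumes "n \<ge> 3"
  shows "cyclic_extension n (Motzkin_star n) Des cDes rho"
  unfolding cyclic_extension_def
proof (intro conjI ballI)
  show "finite (Motzkin_star n)" by (rule finite_Motzkin_star)
  show "bij_betw rho (Motzkin_star n) (Motzkin_star n)" using assms by (simp add: bij_betw_rho)
next
  fix w assume "w \<in> Motzkin_star n"
  then have w: "length w = n" "motzkin_word w" "\<not> set w \<subseteq> {L}" "w \<noteq> []"
    by (auto simp: Motzkin_star_iff)
  show "Des w \<subseteq> {1..n-1}" using Des_subset w by metis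
  show "cDes w \<subseteq> {1..n}" using cDes_subset w by metis
  show "cDes w \<inter> {1..n-1} = Des w" using cDes_Int w by metis
  show "cDes (rho w) = cyc_shift n (cDes w)" using cDes_rho w assms by metis
  show "{} \<subset> cDes w" using Des_nonempty[OF w(2,3)] by (auto simp: cDes_def)
  show "cDes w \<subset> {1..n}" using cDes_psubset w assms by metis
qed

end
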